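(* Let $\mathbb{K}$ be a field of characteristic $2$. Let $(\mathfrak{g},[\cdot,\cdot],s)$ be a Lie superalgebra in characteristic $2$ over $\mathbb{K}$, and let $\alpha:\mathfrak{g}\to\mathfrak{g}$ be an even Lie superalgebra morphism. Put $[\cdot,\cdot]_\alpha:=\alpha\circ[\cdot,\cdot]$ and $s_\alpha:=\alpha\circ s$. Then $(\mathfrak{g},[\cdot,\cdot]_\alpha,s_\alpha,\alpha)$ is a Hom-Lie superalgebra in characteristic $2$.
   Context: All vector spaces are over a field $\mathbb{K}$ of characteristic $2$. A map $s:V\to W$ of vector spaces is a squaring if $s(\lambda x)=\lambda^2 s(x)$ for all $\lambda\in\mathbb{K}$, $x\in V$. Lie superalgebra in characteristic 2: a superspace $\mathfrak{g}=\mathfrak{g}_{\bar 0}\oplus\mathfrak{g}_{\bar 1}$ such that $\mathfrak{g}_{\bar 0}$ is an ordinary Lie algebra, $\mathfrak{g}_{\bar 1}$ is a $\mathfrak{g}_{\bar 0}$-module made two-sided by symmetry (action also denoted $[\cdot,\cdot]$), with a squaring $s:\mathfrak{g}_{\bar 1}\to\mathfrak{g}_{\bar 0}$ such that $[x,y]:=s(x+y)+s(x)+s(y)$ is bilinear on $\mathfrak{g}_{\bar 1}$ (this is the bracket of odd elements), and $[s(x),y]=[x,[x,y]]$ for all $x\in\mathfrak{g}_{\bar 1}$, $y\in\mathfrak{g}$. A morphism of Lie superalgebras is an even linear map $\varphi$ with $\varphi([x,y])=[\varphi(x),\varphi(y)]$ and $\varphi(s(x))=s(\varphi(x))$ for $x$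 odd. Hom-Lie algebra in characteristic 2: $(\mathfrak{g},[\cdot,\cdot],\alpha)$ with $[\cdot,\cdot]$ bilinear, $\alpha\in\mathrm{End}(\mathfrak{g})$, $[x,x]=0$, $\alpha([x,y])=[\alpha(x),\alpha(y)]$, and $[\alpha(x),[y,z]]+[\alpha(y),[z,x]]+[\alpha(z),[x,y]]=0$. A representation of it is $(V,[\cdot,\cdot]_V,\beta)$ with $\beta\in\mathfrak{gl}(V)$ and $[\cdot,\cdot]_V:\mathfrak{g}\times V\to V$ bilinear such that $[\alpha(x),\beta(v)]_V=\beta([x,v]_V)$ and $[[x,y],\beta(v)]_V=[\alpha(x),[y,v]_V]_V+[\alpha(y),[x,v]_V]_V$. Hom-Lie superalgebra in characteristic 2: a quadruple $(\mathfrak{g},[\cdot,\cdot],s,\alpha)$ with $\mathfrak{g}=\mathfrak{g}_{\bar 0}\oplus\mathfrak{g}_{\bar 1}$ a superspace, $[\cdot,\cdot]$ a symmetric bilinear bracket, $s:\mathfrak{g}_{\bar 1}\to\mathfrak{g}_{\bar 0}$ a squaring, and $\alpha\in\mathrm{End}(\mathfrak{g})$ even, such that (i) $(\mathfrak{g}_{\bar 0},[\cdot,\cdot],\alpha|_{\mathfrak{g}_{\bar 0}})$ is a Hom-Lie algebra; (ii) $\mathfrak{g}_{\bar 1}$ is a $\mathfrak{g}_{\bar 0}$-module (with twist $\alpha|_{\mathfrak{g}_{\bar 1}}$) via the bracket, made two-sided by symmetry; (iii) the map $(x,y)\mapsto s(x+y)+s(x)+s(y)$ on $\mathfrak{g}_{\bar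 1}\times\mathfrak{g}_{\bar 1}$ is bilinear and equals $[x,y]$; (iv) $[s(x),\alpha(y)]=[\alpha(x),[x,y]]$ for $x\in\mathfrak{g}_{\bar 1}$, $y\in\mathfrak{g}$; $\alpha([x,y])=[\alpha(x),\alpha(y)]$ for $x,y\in\mathfrak{g}$; and $\alpha(s(x))=s(\alpha(x))$ for $x\in\mathfrak{g}_{\bar 1}$. *)

theory Defs
  imports Complex_Main
begin

text \<open>
  All spaces are subspaces of ambient vector spaces (given by a scaling operation on a type), so that
  the even and odd parts of a superspace live in one and the same type. Maps defined only on a
  subspace (such as the squaring, defined on the odd part) are total functions whose values outside
  that subspace are irrelevant.
\<close>

definition linear_on ::
  "('k::field \<Rightarrow> 'v::ab_group_add \<Rightarrow> 'v) \<Rightarrow> ('k \<Rightarrow> 'w::ab_group_add \<Rightarrow> 'w) \<Rightarrow>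
   'v set \<Rightarrow> 'w set \<Rightarrow> ('v \<Rightarrow> 'w) \<Rightarrow> bool" where
  "linear_on scaleV scaleW V W f \<longleftrightarrow>
     f ` V \<subseteq> W \<and>
     (\<forall>x\<in>V. \<forall>y\<in>V. f (x + y) = f x + f y) \<and>
     (\<forall>c. \<forall>x\<in>V. f (scaleV c x) = scaleW c (f x))"

definition bilinear_on ::
  "('k::field \<Rightarrow> 'u::ab_group_add \<Rightarrow> 'u) \<Rightarrow> ('k \<Rightarrow> 'v::ab_group_add \<Rightarrow> 'v) \<Rightarrow>
   ('k \<Rightarrow> 'w::ab_group_add \<Rightarrow> 'w) \<Rightarrow> 'u set \<Rightarrow> 'v set \<Rightarrow> 'w set \<Rightarrow> ('u \<Rightarrow> 'v \<Rightarrow> 'w) \<Rightarrow> bool" where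
  "bilinear_on scaleU scaleV scaleW U V W f \<longleftrightarrow>
     (\<forall>x\<in>U. linear_on scaleV scaleW V W (f x)) \<and>
     (\<forall>y\<in>V. linear_on scaleU scaleW U W (\<lambda>x. f x y))"

definition squaring_on ::
  "('k::field \<Rightarrow> 'v::ab_group_add \<Rightarrow> 'v) \<Rightarrow> ('k \<Rightarrow> 'w::ab_group_add \<Rightarrow> 'w) \<Rightarrow>
   'v set \<Rightarrow> 'w set \<Rightarrow> ('v \<Rightarrow> 'w) \<Rightarrow> bool" where
  "squaring_on scaleV scaleW V W s \<longleftrightarrow>
     s ` V \<subseteq> W \<and> (\<forall>c. \<forall>x\<in>V. s (scaleV c x) = scaleW (c\<^sup>2) (s x))"

locale char2_vector_space = vector_space scale
  for scale :: "'k::field \<Rightarrow> 'v::ab_group_add \<Rightarrow> 'v" +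
  assumes char_2: "CHAR('k) = 2"

locale char2_superspace = char2_vector_space scale
  for scale :: "'k::field \<Rightarrow> 'v::ab_group_add \<Rightarrow> 'v" +
  fixes g0 g1 :: "'v set"
  assumes subspace_even: "subspace g0"
    and subspace_odd: "subspace g1"
    and even_Int_odd: "g0 \<inter> g1 = {0}"
    and even_plus_odd: "\<exists>a\<in>g0. \<exists>b\<in>g1. x = a + b"

subsection \<open>Lie superalgebras in characteristic 2\<close>

locale char2_lie_algebra = char2_vector_space scale
  for scale :: "'k::field \<Rightarrow> 'v::ab_group_add \<Rightarrow> 'v" +
  fixes g :: "'v set" and br :: "'v \<Rightarrow> 'v \<Rightarrow> 'v"
  assumes subspace_carrier: "subspace g"
    and bracket_bilinear: "bilinear_on scale scale scale g g g br"
    and bracket_self: "x \<in> g \<Longrightarrow> br x x = 0"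
    and jacobi: "\<lbrakk>x \<in> g; y \<in> g; z \<in> g\<rbrakk> \<Longrightarrow>
      br x (br y z) + br y (br z x) + br z (br x y) = 0"

locale char2_lie_module =
  char2_lie_algebra scale g br + V: char2_vector_space scaleV
  for scale :: "'k::field \<Rightarrow> 'v::ab_group_add \<Rightarrow> 'v" and g br
    and scaleV :: "'k \<Rightarrow> 'w::ab_group_add \<Rightarrow> 'w" +
  fixes V :: "'w set" and act :: "'v \<Rightarrow> 'w \<Rightarrow> 'w"
  assumes subspace_module: "V.subspace V"
    and act_bilinear: "bilinear_on scale scaleV scaleV g V V act"
    and act_bracket: "\<lbrakk>x \<in> g; y \<in> g; v \<in> V\<rbrakk> \<Longrightarrow>
      act (br x y) v = act x (act y v) + act y (act x v)"

text \<open>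
  The bracket on the whole space is the bilinear map assembled from the Lie bracket of the even part,
  the two-sided action of the even part on the odd part, and the polarization of the squaring.
\<close>

locale char2_lie_superalgebra =
  char2_superspace scale g0 g1 +
  even: char2_lie_algebra scale g0 br +
  odd: char2_lie_module scale g0 br scale g1 br
  for scale :: "'k::field \<Rightarrow> 'v::ab_group_add \<Rightarrow> 'v" and g0 g1 and br :: "'v \<Rightarrow> 'v \<Rightarrow> 'v" +
  fixes s :: "'v \<Rightarrow> 'v"
  assumes super_bracket_bilinear: "bilinear_on scale scale scale UNIV UNIV UNIV br"
    and even_odd_sym: "\<lbrakk>x \<in> g0; y \<in> g1\<rbrakk> \<Longrightarrow> br y x = br x y"
    and squaring: "squaring_on scale scale g1 g0 s"
    and polarization_bilinear:
      "bilinear_on scale scale scale g1 g1 g0 (\<lambda>x y. s (x + y) + s x + s y)"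
    and odd_bracket: "\<lbrakk>x \<in> g1; y \<in> g1\<rbrakk> \<Longrightarrow> br x y = s (x + y) + s x + s y"
    and bracket_squaring: "x \<in> g1 \<Longrightarrow> br (s x) y = br x (br x y)"

locale char2_lie_superalgebra_morphism =
  dom: char2_lie_superalgebra scale g0 g1 br s +
  cod: char2_lie_superalgebra scale' g0' g1' br' s' +
  Vector_Spaces.linear scale scale' \<phi>
  for scale :: "'k::field \<Rightarrow> 'v::ab_group_add \<Rightarrow> 'v" and g0 g1 br s
    and scale' :: "'k \<Rightarrow> 'w::ab_group_add \<Rightarrow> 'w" and g0' g1' br' s'
    and \<phi> :: "'v \<Rightarrow> 'w" +
  assumes map_even: "\<phi> ` g0 \<subseteq> g0'"
    and map_odd: "\<phi> ` g1 \<subseteq> g1'"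
    and map_bracket: "\<phi> (br x y) = br' (\<phi> x) (\<phi> y)"
    and map_squaring: "x \<in> g1 \<Longrightarrow> \<phi> (s x) = s' (\<phi> x)"

subsection \<open>Hom-Lie superalgebras in characteristic 2\<close>

locale char2_hom_lie_algebra = char2_vector_space scale
  for scale :: "'k::field \<Rightarrow> 'v::ab_group_add \<Rightarrow> 'v" +
  fixes g :: "'v set" and br :: "'v \<Rightarrow> 'v \<Rightarrow> 'v" and \<alpha> :: "'v \<Rightarrow> 'v"
  assumes subspace_carrier: "subspace g"
    and bracket_bilinear: "bilinear_on scale scale scale g g g br"
    and twist_linear: "linear_on scale scale g g \<alpha>"
    and bracket_self: "x \<in> g \<Longrightarrow> br x x = 0"
    and twist_bracket: "\<lbrakk>x \<in> g; y \<in> g\<rbrakk> \<Longrightarrow> \<alpha> (br x y) = br (\<alpha> x) (\<alpha> y)"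
    and hom_jacobi: "\<lbrakk>x \<in> g; y \<in> g; z \<in> g\<rbrakk> \<Longrightarrow>
      br (\<alpha> x) (br y z) + br (\<alpha> y) (br z x) + br (\<alpha> z) (br x y) = 0"

locale char2_hom_lie_representation =
  char2_hom_lie_algebra scale g br \<alpha> + V: char2_vector_space scaleV
  for scale :: "'k::field \<Rightarrow> 'v::ab_group_add \<Rightarrow> 'v" and g br \<alpha>
    and scaleV :: "'k \<Rightarrow> 'w::ab_group_add \<Rightarrow> 'w" +
  fixes V :: "'w set" and act :: "'v \<Rightarrow> 'w \<Rightarrow> 'w" and \<beta> :: "'w \<Rightarrow> 'w"
  assumes subspace_module: "V.subspace V"
    and act_bilinear: "bilinear_on scale scaleV scaleV g V V act"
    and module_twist_linear: "linear_on scaleV scaleV V V \<beta>"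
    and twist_act: "\<lbrakk>x \<in> g; v \<in> V\<rbrakk> \<Longrightarrow> act (\<alpha> x) (\<beta> v) = \<beta> (act x v)"
    and act_bracket: "\<lbrakk>x \<in> g; y \<in> g; v \<in> V\<rbrakk> \<Longrightarrow>
      act (br x y) (\<beta> v) = act (\<alpha> x) (act y v) + act (\<alpha> y) (act x v)"

locale char2_hom_lie_superalgebra =
  char2_superspace scale g0 g1 +
  even: char2_hom_lie_algebra scale g0 br \<alpha> +
  odd: char2_hom_lie_representation scale g0 br \<alpha> scale g1 br \<alpha> +
  Vector_Spaces.linear scale scale \<alpha>
  for scale :: "'k::field \<Rightarrow> 'v::ab_group_add \<Rightarrow> 'v" and g0 g1 and br :: "'v \<Rightarrow> 'v \<Rightarrow> 'v"
    and s :: "'v \<Rightarrow> 'v" and \<alpha> :: "'v \<Rightarrow> 'v" +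
  assumes super_bracket_bilinear: "bilinear_on scale scale scale UNIV UNIV UNIV br"
    and super_bracket_sym: "br x y = br y x"
    and squaring: "squaring_on scale scale g1 g0 s"
    and super_twist_even: "\<alpha> ` g0 \<subseteq> g0"
    and super_twist_odd: "\<alpha> ` g1 \<subseteq> g1"
    and polarization_bilinear:
      "bilinear_on scale scale scale g1 g1 g0 (\<lambda>x y. s (x + y) + s x + s y)"
    and odd_bracket: "\<lbrakk>x \<in> g1; y \<in> g1\<rbrakk> \<Longrightarrow> s (x + y) + s x + s y = br x y"
    and bracket_squaring: "x \<in> g1 \<Longrightarrow> br (s x) (\<alpha> y) = br (\<alpha> x) (br x y)"
    and super_twist_bracket: "\<alpha> (br x y) = br (\<alpha> x) (\<alpha> y)"
    and twist_squaring: "x \<in> g1 \<Longrightarrow> \<alpha> (s x) = s (\<alpha> x)"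

end

theory Submission
  imports Defs
begin

text \<open>
  This is Yau's twisting principle. The identities of degree three (Jacobi, module action of a
  bracket, bracket with a square) nest two operations. In their Hom-versions the arguments that
  pass through only one of the two are twisted by \<open>\<alpha>\<close>, and each operation \<open>\<alpha> \<circ> br\<close> or
  \<open>\<alpha> \<circ> s\<close> contributes one further \<open>\<alpha>\<close>. As \<open>\<alpha>\<close> commutes with the bracket and the squaring,
  exactly two copies of it can be pulled to the front of every term, for example
  \<open>\<alpha> (br (\<alpha> x) (\<alpha> (br y z))) = \<alpha> (\<alpha> (br x (br y z)))\<close>. Hence each of these Hom-identities is the
  image of the untwisted one under the additive map \<open>\<alpha> \<circ> \<alpha>\<close>. Identities with a single
  operation, such as the polarization formula, are applied once under \<open>\<alpha>\<close>.

  The argument is carried out for Lie algebras (\<open>yau_twist_lie_algebra\<close>), for their modules with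
  a compatible twist (\<open>yau_twist_lie_module\<close>), and finally for the squaring. Symmetry of the
  bracket on the whole space needs an argument of its own, because a Lie superalgebra only
  postulates it between even and odd elements (\<open>super_bracket_commute\<close>).
\<close>

section \<open>Composing multilinear maps with a linear map\<close>

lemma linear_on_zero:
  assumes "linear_on scaleV scaleW V W f" and "0 \<in> V"
  shows "f 0 = 0"
proof -
  have "f (0 + 0) = f 0 + f 0"
    using assms unfolding linear_on_def by blast
  then show ?thesis by simp
qed

lemma linear_on_compose:
  assumes "linear_on scaleU scaleV U V f" and "linear_on scaleV scaleW V W g"
  shows "linear_on scaleU scaleW U W (\<lambda>x. g (f x))"
  using assms unfolding linear_on_def by (auto simp: image_subset_iff)

lemma bilinear_on_compose:
  assumes "bilinear_on scaleU scaleV scaleW U V W f" and "linear_on scaleW scaleX W X g"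
  shows "bilinear_on scaleU scaleV scaleX U V X (\<lambda>x y. g (f x y))"
  using assms(1) unfolding bilinear_on_def
  by (auto intro: linear_on_compose[OF _ assms(2)])

lemma bilinear_on_closed:
  assumes "bilinear_on scaleU scaleV scaleW U V W f" and "x \<in> U" and "y \<in> V"
  shows "f x y \<in> W"
  using assms unfolding bilinear_on_def linear_on_def by blast

lemma bilinear_on_add_left:
  assumes "bilinear_on scaleU scaleV scaleW U V W f" and "x \<in> U" "x' \<in> U" "y \<in> V"
  shows "f (x + x') y = f x y + f x' y"
  using assms unfolding bilinear_on_def linear_on_def by blast

lemma bilinear_on_add_right:
  assumes "bilinear_on scaleU scaleV scaleW U V W f" and "x \<in> U" "y \<in> V" "y' \<in> V"
  shows "f x (y + y') = f x y + f x y'"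
  using assms unfolding bilinear_on_def linear_on_def by blast

lemma squaring_on_compose:
  assumes "squaring_on scaleV scaleW V W s" and "linear_on scaleW scaleX W X g"
  shows "squaring_on scaleV scaleX V X (g \<circ> s)"
  using assms unfolding squaring_on_def linear_on_def by (auto simp: image_subset_iff)

lemma (in Vector_Spaces.linear) linear_on_restrict:
  assumes "f ` V \<subseteq> W"
  shows "linear_on s1 s2 V W f"
  using assms unfolding linear_on_def by (simp add: add scale)

section \<open>Symmetry of brackets in characteristic 2\<close>

lemma (in char2_vector_space) add_self: "x + x = (0::'v)"
proof -
  have "(1 + 1::'k) = 0"
    using of_nat_CHAR[where 'a = 'k] char_2 by simp
  then have "scale (1 + 1) x = 0"
    by simp
  then show ?thesis
    by (simp only: scale_left_distrib scale_one)
qed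

lemma (in char2_vector_space) add_eq_zero_iff: "x + y = 0 \<longleftrightarrow> x = y" for x y :: 'v
  by (metis add_self add_right_cancel)

lemma (in char2_lie_algebra) bracket_commute:
  assumes "x \<in> g" and "y \<in> g"
  shows "br x y = br y x"
proof -
  have "x + y \<in> g"
    using assms by (rule subspace_add[OF subspace_carrier])
  then have "0 = br (x + y) (x + y)"
    by (simp add: bracket_self)
  also have "\<dots> = (br x x + br y x) + (br x y + br y y)"
    using assms \<open>x + y \<in> g\<close>
    by (simp only: bilinear_on_add_left[OF bracket_bilinear]
        bilinear_on_add_right[OF bracket_bilinear])
  also have "\<dots> = br x y + br y x"
    using assms by (simp add: bracket_self add.commute)
  finally show ?thesis
    by (metis add_eq_zero_iff)
qed

text \<open>
  By bilinearity it suffices to compare brackets of homogeneous elements. For even elements the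
  bracket is alternating, hence symmetric since signs do not matter; for odd ones it is a
  polarization, which is visibly symmetric; the mixed case is the two-sidedness of the module.
\<close>

lemma (in char2_lie_superalgebra) super_bracket_commute: "br x y = br y x"
proof -
  obtain a b where x: "x = a + b" "a \<in> g0" "b \<in> g1"
    using even_plus_odd by blast
  obtain c d where y: "y = c + d" "c \<in> g0" "d \<in> g1"
    using even_plus_odd by blast
  have even: "br a c = br c a"
    using x y by (intro even.bracket_commute)
  have mixed: "br b c = br c b" "br d a = br a d"
    using x y by (auto intro: even_odd_sym)
  have odd: "br b d = br d b"
    using x y by (simp add: odd_bracket add_ac)
  show ?thesis
    unfolding x(1) y(1)
    by (simp add: bilinear_on_add_left[OF super_bracket_bilinear]
        bilinear_on_add_right[OF super_bracket_bilinear] even mixed odd add_ac)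
qed

section \<open>Twisting Lie algebras and their modules\<close>

lemma (in char2_lie_algebra) yau_twist_lie_algebra:
  assumes linear: "linear_on scale scale g g \<alpha>"
    and hom: "\<And>x y. \<lbrakk>x \<in> g; y \<in> g\<rbrakk> \<Longrightarrow> \<alpha> (br x y) = br (\<alpha> x) (\<alpha> y)"
  shows "char2_hom_lie_algebra scale g (\<lambda>x y. \<alpha> (br x y)) \<alpha>"
proof unfold_locales
  have zero: "\<alpha> 0 = 0"
    using linear subspace_0[OF subspace_carrier] by (rule linear_on_zero)
  have closed: "br x y \<in> g" if "x \<in> g" "y \<in> g" for x y
    using bracket_bilinear that by (rule bilinear_on_closed)
  have twist_closed: "\<alpha> x \<in> g" if "x \<in> g" for x
    using linear that unfolding linear_on_def by blast
  have add: "\<alpha> (x + y) = \<alpha> x + \<alpha> y" if "x \<in> g" "y \<in> g" for x y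
    using linear that unfolding linear_on_def by blast
  have add_closed: "x + y \<in> g" if "x \<in> g" "y \<in> g" for x y
    using that by (rule subspace_add[OF subspace_carrier])
  show "subspace g"
    by (rule subspace_carrier)
  show "bilinear_on scale scale scale g g g (\<lambda>x y. \<alpha> (br x y))"
    using bracket_bilinear linear by (rule bilinear_on_compose)
  show "linear_on scale scale g g \<alpha>"
    by (rule linear)
  show "\<alpha> (br x x) = 0" if "x \<in> g" for x
    using that by (simp add: bracket_self zero)
  show "\<alpha> (\<alpha> (br x y)) = \<alpha> (br (\<alpha> x) (\<alpha> y))" if "x \<in> g" "y \<in> g" for x y
    using that by (simp add: hom)
  show "\<alpha> (br (\<alpha> x) (\<alpha> (br y z))) + \<alpha> (br (\<alpha> y) (\<alpha> (br z x)))
      + \<alpha> (br (\<alpha> z) (\<alpha> (br x y))) = 0"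
    if xyz: "x \<in> g" "y \<in> g" "z \<in> g" for x y z
  proof -
    have "\<alpha> (br (\<alpha> x) (\<alpha> (br y z))) + \<alpha> (br (\<alpha> y) (\<alpha> (br z x)))
        + \<alpha> (br (\<alpha> z) (\<alpha> (br x y)))
      = \<alpha> (\<alpha> (br x (br y z))) + \<alpha> (\<alpha> (br y (br z x))) + \<alpha> (\<alpha> (br z (br x y)))"
      using xyz by (simp only: hom[symmetric] closed)
    also have "\<dots> = \<alpha> (\<alpha> (br x (br y z) + br y (br z x) + br z (br x y)))"
      using xyz by (simp only: add closed twist_closed add_closed)
    also have "\<dots> = 0"
      using xyz by (simp add: jacobi zero)
    finally show ?thesis .
  qed
qed

lemma (in char2_lie_module) yau_twist_lie_module:
  assumes linear: "linear_on scale scale g g \<alpha>"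
    and hom: "\<And>x y. \<lbrakk>x \<in> g; y \<in> g\<rbrakk> \<Longrightarrow> \<alpha> (br x y) = br (\<alpha> x) (\<alpha> y)"
    and module_linear: "linear_on scaleV scaleV V V \<beta>"
    and equivariant: "\<And>x v. \<lbrakk>x \<in> g; v \<in> V\<rbrakk> \<Longrightarrow> \<beta> (act x v) = act (\<alpha> x) (\<beta> v)"
  shows "char2_hom_lie_representation scale g (\<lambda>x y. \<alpha> (br x y)) \<alpha>
    scaleV V (\<lambda>x v. \<beta> (act x v)) \<beta>"
proof -
  interpret hom_lie: char2_hom_lie_algebra scale g "\<lambda>x y. \<alpha> (br x y)" \<alpha>
    using linear hom by (rule yau_twist_lie_algebra)
  have closed: "br x y \<in> g" if "x \<in> g" "y \<in> g" for x y
    using bracket_bilinear that by (rule bilinear_on_closed)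
  have act_closed: "act x v \<in> V" if "x \<in> g" "v \<in> V" for x v
    using act_bilinear that by (rule bilinear_on_closed)
  have twist_closed: "\<beta> v \<in> V" if "v \<in> V" for v
    using module_linear that unfolding linear_on_def by blast
  have add: "\<beta> (v + w) = \<beta> v + \<beta> w" if "v \<in> V" "w \<in> V" for v w
    using module_linear that unfolding linear_on_def by blast
  show ?thesis
  proof unfold_locales
    show "V.subspace V"
      by (rule subspace_module)
    show "bilinear_on scale scaleV scaleV g V V (\<lambda>x v. \<beta> (act x v))"
      using act_bilinear module_linear by (rule bilinear_on_compose)
    show "linear_on scaleV scaleV V V \<beta>"
      by (rule module_linear)
    show "\<beta> (act (\<alpha> x) (\<beta> v)) = \<beta> (\<beta> (act x v))" if "x \<in> g" "v \<in> V" for x v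
      using that by (simp add: equivariant)
    show "\<beta> (act (\<alpha> (br x y)) (\<beta> v))
        = \<beta> (act (\<alpha> x) (\<beta> (act y v))) + \<beta> (act (\<alpha> y) (\<beta> (act x v)))"
      if xyv: "x \<in> g" "y \<in> g" "v \<in> V" for x y v
    proof -
      have "\<beta> (act (\<alpha> (br x y)) (\<beta> v)) = \<beta> (\<beta> (act (br x y) v))"
        using xyv by (simp only: equivariant[symmetric] closed)
      also have "\<dots> = \<beta> (\<beta> (act x (act y v))) + \<beta> (\<beta> (act y (act x v)))"
        using xyv by (simp only: act_bracket add act_closed twist_closed)
      also have "\<dots> = \<beta> (act (\<alpha> x) (\<beta> (act y v))) + \<beta> (act (\<alpha> y) (\<beta> (act x v)))"
        using xyv by (simp only: equivariant[symmetric] act_closed)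
      finally show ?thesis .
    qed
  qed
qed

section \<open>Twisting Lie superalgebras\<close>

theorem proposition2p4:
  fixes scale :: "'k::field \<Rightarrow> 'v::ab_group_add \<Rightarrow> 'v"
    and g0 g1 :: "'v set"
    and br :: "'v \<Rightarrow> 'v \<Rightarrow> 'v"
    and s \<alpha> :: "'v \<Rightarrow> 'v"
  assumes "CHAR('k) = 2"
    and "char2_lie_superalgebra scale g0 g1 br s"
    and "char2_lie_superalgebra_morphism scale g0 g1 br s scale g0 g1 br s \<alpha>"
  shows "char2_hom_lie_superalgebra scale g0 g1 (\<lambda>x y. \<alpha> (br x y)) (\<alpha> \<circ> s) \<alpha>"
proof -
  interpret lie: char2_lie_superalgebra scale g0 g1 br s
    by (rule assms(2))
  interpret mor: char2_lie_superalgebra_morphism scale g0 g1 br s scale g0 g1 br s \<alpha>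
    by (rule assms(3))
  have linear: "linear_on scale scale UNIV UNIV \<alpha>"
    and linear_even: "linear_on scale scale g0 g0 \<alpha>"
    and linear_odd: "linear_on scale scale g1 g1 \<alpha>"
    using mor.map_even mor.map_odd by (auto intro: mor.linear_on_restrict)
  interpret rep: char2_hom_lie_representation scale g0 "\<lambda>x y. \<alpha> (br x y)" \<alpha>
      scale g1 "\<lambda>x y. \<alpha> (br x y)" \<alpha>
    using linear_even mor.map_bracket linear_odd mor.map_bracket
    by (rule lie.odd.yau_twist_lie_module)
  \<comment> \<open>Polarization is additive in the squaring, so it commutes with twisting.\<close>
  have polarization: "(\<alpha> \<circ> s) (x + y) + (\<alpha> \<circ> s) x + (\<alpha> \<circ> s) y = \<alpha> (s (x + y) + s x + s y)" for x y
    by (simp add: mor.add)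
  show ?thesis
  proof unfold_locales
    show "bilinear_on scale scale scale UNIV UNIV UNIV (\<lambda>x y. \<alpha> (br x y))"
      using lie.super_bracket_bilinear linear by (rule bilinear_on_compose)
    show "\<alpha> (br x y) = \<alpha> (br y x)" for x y
      by (simp only: lie.super_bracket_commute[of x y])
    show "squaring_on scale scale g1 g0 (\<alpha> \<circ> s)"
      using lie.squaring linear_even by (rule squaring_on_compose)
    show "\<alpha> ` g0 \<subseteq> g0" "\<alpha> ` g1 \<subseteq> g1"
      by (rule mor.map_even mor.map_odd)+
    show "bilinear_on scale scale scale g1 g1 g0
        (\<lambda>x y. (\<alpha> \<circ> s) (x + y) + (\<alpha> \<circ> s) x + (\<alpha> \<circ> s) y)"
      unfolding polarization
      using lie.polarization_bilinear linear_even by (rule bilinear_on_compose)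
    show "(\<alpha> \<circ> s) (x + y) + (\<alpha> \<circ> s) x + (\<alpha> \<circ> s) y = \<alpha> (br x y)"
      if "x \<in> g1" "y \<in> g1" for x y
      unfolding polarization using that by (simp only: lie.odd_bracket)
    show "\<alpha> (br ((\<alpha> \<circ> s) x) (\<alpha> y)) = \<alpha> (br (\<alpha> x) (\<alpha> (br x y)))" if "x \<in> g1" for x y
      using that by (simp only: o_apply mor.map_bracket[symmetric] lie.bracket_squaring)
    show "\<alpha> (\<alpha> (br x y)) = \<alpha> (br (\<alpha> x) (\<alpha> y))" for x y
      by (simp only: mor.map_bracket)
    show "\<alpha> ((\<alpha> \<circ> s) x) = (\<alpha> \<circ> s) (\<alpha> x)" if "x \<in> g1" for x
      using that by (simp only: o_apply mor.map_squaring)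
  qed
qed

end
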